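(* Let $Y\in\mathcal{B}(H^2\oplus H^2)$. Then $$(S\oplus S^* )Y=Y^*(S\oplus S^* )^*$$ if and only if $$Y=\begin{pmatrix} A_{11}S^* & S^*D^*S\\ Y_{21} & P_{\langle1\rangle}T+A_{22}S+SB_{22}\end{pmatrix}$$ for some bounded operators $Y_{21}$ and $T$ on $H^2$ and self-adjoint operators $A_{11},A_{22},B_{22}$ on $H^2$, where the operator matrix of $Y_{21}$ in the decomposition $\langle1\rangle\oplus zH^2$ of $H^2$ is given by $$Y_{21}=\begin{pmatrix} a & g\\ 0 & D\end{pmatrix}$$ for some $a\in\mathbb{C}$, $g\in\mathcal{B}(zH^2,\langle1\rangle)$ and $D\in\mathcal{B}(zH^2)$.
   Context: $H^2$ is the (scalar) Hardy–Hilbert space of holomorphic functions $f(z)=\sum_{n\ge0}a_nz^n$ on the unit disk with $\sum|a_n|^2<\infty$; $S$ is the unilateral shift $(Sf)(z)=zf(z)$ on $H^2$, whose range is $zH^2$; $\langle1\rangle$ is the subspace of constant functions and $P_{\langle1\rangle}$ is the orthogonal projection of $H^2$ onto it. $\mathcal{B}(\cdot)$ and $\mathcal{B}(\cdot,\cdot)$ denote bounded linear operators; self-adjoint operators are bounded. Since $S$ maps $H^2$ into $zH^2$ and $D^*$ acts on $zH^2\subset H^2$, the operator $S^*D^*S$ is a bounded operator on $H^2$. The block matrix of $Y$ is with respect to $H^2\oplus H^2$. *)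

theory Defs
  imports "HOL-Complex_Analysis.Complex_Analysis"
begin

section \<open>Complex inner product spaces\<close>

text \<open>The complex inner product is linear in its first argument. Its real part is the inner product
  of \<^class>\<open>real_inner\<close>, so norm and topology are those of the library.\<close>

class complex_inner = real_inner +
  fixes scaleC :: "complex \<Rightarrow> 'a \<Rightarrow> 'a"  (infixr "*\<^sub>C" 75)
    and cinner :: "'a \<Rightarrow> 'a \<Rightarrow> complex"
  assumes scaleC_add_right: "c *\<^sub>C (x + y) = c *\<^sub>C x + c *\<^sub>C y"
    and scaleC_add_left: "(c + d) *\<^sub>C x = c *\<^sub>C x + d *\<^sub>C x"
    and scaleC_scaleC: "c *\<^sub>C d *\<^sub>C x = (c * d) *\<^sub>C x"
    and scaleC_of_real: "complex_of_real r *\<^sub>C x = r *\<^sub>R x"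
    and cinner_commute: "cinner x y = cnj (cinner y x)"
    and cinner_add_left: "cinner (x + y) z = cinner x z + cinner y z"
    and cinner_scaleC_left: "cinner (c *\<^sub>C x) y = c * cinner x y"
    and Re_cinner: "Re (cinner x y) = inner x y"

lemma norm_eq_sqrt_cinner:
  fixes x :: "'a :: complex_inner"
  shows "norm x = sqrt (Re (cinner x x))"
  by (simp add: norm_eq_sqrt_inner Re_cinner)

instantiation prod :: (complex_inner, complex_inner) complex_inner
begin

definition scaleC_prod :: "complex \<Rightarrow> 'a \<times> 'b \<Rightarrow> 'a \<times> 'b"
  where "c *\<^sub>C p = (c *\<^sub>C fst p, c *\<^sub>C snd p)"

definition cinner_prod :: "'a \<times> 'b \<Rightarrow> 'a \<times> 'b \<Rightarrow> complex"
  where "cinner p q = cinner (fst p) (fst q) + cinner (snd p) (snd q)"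

instance
proof
  fix p q :: "'a \<times> 'b"
  show "cinner p q = cnj (cinner q p)"
    unfolding cinner_prod_def by (metis cinner_commute complex_cnj_add)
qed (auto simp: scaleC_prod_def cinner_prod_def scaleC_add_right scaleC_add_left scaleC_scaleC
      scaleC_of_real cinner_add_left cinner_scaleC_left Re_cinner inner_prod_def scaleR_prod_def
      algebra_simps)

end

section \<open>Bounded operators\<close>

text \<open>\<open>bounded_ops M N\<close> is \<open>\<B>(M, N)\<close> for subspaces \<open>M\<close>, \<open>N\<close>. An operator on \<open>M\<close> is represented by a
  total function whose values outside \<open>M\<close> are irrelevant.\<close>

definition bounded_ops ::
  "'a::complex_inner set \<Rightarrow> 'b::complex_inner set \<Rightarrow> ('a \<Rightarrow> 'b) set" where
  "bounded_ops M N = {T. (\<forall>x\<in>M. T x \<in> N) \<and>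
     (\<forall>x\<in>M. \<forall>y\<in>M. T (x + y) = T x + T y) \<and>
     (\<forall>c. \<forall>x\<in>M. T (c *\<^sub>C x) = c *\<^sub>C T x) \<and>
     (\<exists>K. \<forall>x\<in>M. norm (T x) \<le> K * norm x)}"

lemma bounded_ops_UNIV_iff:
  "T \<in> bounded_ops UNIV UNIV \<longleftrightarrow> bounded_linear T \<and> (\<forall>c x. T (c *\<^sub>C x) = c *\<^sub>C T x)"
  unfolding bounded_ops_def bounded_linear_def bounded_linear_axioms_def linear_iff
  by (auto simp: mult.commute simp flip: scaleC_of_real)

text \<open>The Hilbert space adjoint in \<open>\<B>(N, M)\<close> of an operator \<open>T\<close> in \<open>\<B>(M, N)\<close>, where \<open>M\<close> and \<open>N\<close> are
  Hilbert spaces in their own right under the restricted inner product: \<open>adjoint_on M N T y\<close> is the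
  Riesz representative in \<open>M\<close> of the functional \<open>u \<mapsto> \<langle>T u, y\<rangle>\<close>.\<close>

definition adjoint_on ::
  "'a::complex_inner set \<Rightarrow> 'b::complex_inner set \<Rightarrow> ('a \<Rightarrow> 'b) \<Rightarrow> 'b \<Rightarrow> 'a" where
  "adjoint_on M N T y = (THE x. x \<in> M \<and> (\<forall>u\<in>M. cinner (T u) y = cinner u x))"

abbreviation adj :: "('a::complex_inner \<Rightarrow> 'b::complex_inner) \<Rightarrow> 'b \<Rightarrow> 'a"
  where "adj T \<equiv> adjoint_on UNIV UNIV T"

definition selfadjoint_op :: "('a::complex_inner \<Rightarrow> 'a) \<Rightarrow> bool"
  where "selfadjoint_op A \<longleftrightarrow> A \<in> bounded_ops UNIV UNIV \<and> adj A = A"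

definition ortho_proj :: "'a::complex_inner set \<Rightarrow> 'a \<Rightarrow> 'a"
  where "ortho_proj M x = (THE y. y \<in> M \<and> (\<forall>u\<in>M. cinner (x - y) u = 0))"

text \<open>The operator on the external direct sum given by a 2-by-2 operator matrix, listed row by row.\<close>

definition block_op ::
  "('a \<Rightarrow> 'c) \<Rightarrow> ('b \<Rightarrow> 'c) \<Rightarrow> ('a \<Rightarrow> 'd) \<Rightarrow> ('b \<Rightarrow> 'd)
    \<Rightarrow> 'a \<times> 'b \<Rightarrow> 'c::complex_inner \<times> 'd::complex_inner" where
  "block_op T11 T12 T21 T22 = (\<lambda>(x, y). (T11 x + T12 y, T21 x + T22 y))"

text \<open>The operator matrix of \<open>T\<close> with respect to an internal orthogonal decomposition \<open>M \<oplus> N\<close> of the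
  space, again row by row.\<close>

definition has_op_matrix ::
  "'a::complex_inner set \<Rightarrow> 'a set \<Rightarrow> ('a \<Rightarrow> 'a)
    \<Rightarrow> ('a \<Rightarrow> 'a) \<Rightarrow> ('a \<Rightarrow> 'a) \<Rightarrow> ('a \<Rightarrow> 'a) \<Rightarrow> ('a \<Rightarrow> 'a) \<Rightarrow> bool" where
  "has_op_matrix M N T T11 T12 T21 T22 \<longleftrightarrow>
     T11 \<in> bounded_ops M M \<and> T12 \<in> bounded_ops N M \<and>
     T21 \<in> bounded_ops M N \<and> T22 \<in> bounded_ops N N \<and>
     (\<forall>x\<in>M. \<forall>y\<in>N. T (x + y) = (T11 x + T12 y) + (T21 x + T22 y))"

section \<open>The Hardy--Hilbert space\<close>

definition taylor_coeff :: "(complex \<Rightarrow> complex) \<Rightarrow> nat \<Rightarrow> complex"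
  where "taylor_coeff f n = (deriv ^^ n) f 0 / fact n"

text \<open>A function on the unit disk is represented by its extension by 0, so that equality of elements
  of the type is equality on the disk.\<close>

definition hardy_functions :: "(complex \<Rightarrow> complex) set" where
  "hardy_functions = {f. f holomorphic_on ball 0 1 \<and> (\<forall>z. z \<notin> ball 0 1 \<longrightarrow> f z = 0) \<and>
     summable (\<lambda>n. (cmod (taylor_coeff f n))\<^sup>2)}"

lemma hardy_has_fps:
  assumes "f holomorphic_on ball 0 1"
  shows "f has_fps_expansion Abs_fps (taylor_coeff f)"
  using has_fps_expansion_fps_expansion[of "ball 0 1" f] assms
  by (simp add: fps_expansion_def taylor_coeff_def[abs_def])

lemma taylor_coeff_eqI:
  assumes "f has_fps_expansion F"
  shows "taylor_coeff f n = fps_nth F n"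
  using fps_nth_fps_expansion[OF assms] by (simp add: taylor_coeff_def)

lemma holomorphic_eq_on_disk:
  assumes f: "f holomorphic_on ball 0 1" and g: "g holomorphic_on ball 0 1"
    and eq: "\<And>n. taylor_coeff f n = taylor_coeff g n" and z: "z \<in> ball 0 1"
  shows "f z = g z"
proof -
  have "(\<lambda>n. (deriv ^^ n) f 0 / fact n * (z - 0) ^ n) sums f z"
    using holomorphic_power_series[OF f z] .
  moreover have "(\<lambda>n. (deriv ^^ n) g 0 / fact n * (z - 0) ^ n) sums g z"
    using holomorphic_power_series[OF g z] .
  moreover have "(deriv ^^ n) f 0 / fact n = (deriv ^^ n) g 0 / fact n" for n
    using eq[of n] by (simp add: taylor_coeff_def)
  ultimately show ?thesis using sums_unique2 by fastforce
qed

lemma hardy_zero: "(\<lambda>_. 0) \<in> hardy_functions"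
proof -
  have "taylor_coeff (\<lambda>_. 0) n = 0" for n
    using taylor_coeff_eqI[OF has_fps_expansion_0] by simp
  then show ?thesis by (simp add: hardy_functions_def)
qed

lemma taylor_coeff_add:
  assumes "f holomorphic_on ball 0 1" "g holomorphic_on ball 0 1"
  shows "taylor_coeff (\<lambda>z. f z + g z) n = taylor_coeff f n + taylor_coeff g n"
  using taylor_coeff_eqI[OF has_fps_expansion_add[OF assms[THEN hardy_has_fps]]] by simp

lemma taylor_coeff_cmult:
  assumes "f holomorphic_on ball 0 1"
  shows "taylor_coeff (\<lambda>z. c * f z) n = c * taylor_coeff f n"
  using taylor_coeff_eqI[OF has_fps_expansion_cmult_left[OF hardy_has_fps[OF assms]]] by simp

lemma taylor_coeff_shift:
  assumes "f holomorphic_on ball 0 1"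
  shows "taylor_coeff (\<lambda>z. z * f z) n = (case n of 0 \<Rightarrow> 0 | Suc m \<Rightarrow> taylor_coeff f m)"
  using taylor_coeff_eqI[OF has_fps_expansion_mult[OF has_fps_expansion_fps_X hardy_has_fps[OF assms]], of n]
  by (cases n) simp_all

lemma taylor_coeff_const_disk:
  "taylor_coeff (\<lambda>z. if z \<in> ball 0 1 then c else 0) n = (if n = 0 then c else 0)"
proof -
  have "(\<lambda>z. if z \<in> ball 0 1 then c else 0) has_fps_expansion fps_const c"
  proof (subst has_fps_expansion_cong[OF _ refl])
    show "\<forall>\<^sub>F z in nhds 0. (if z \<in> ball 0 1 then c else 0) = c"
      by (rule eventually_nhds_in_open[of "ball 0 1", THEN eventually_mono]) auto
    show "(\<lambda>_. c) has_fps_expansion fps_const c" by simp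
  qed
  from taylor_coeff_eqI[OF this] show ?thesis by simp
qed

lemma hardy_add:
  assumes f: "f \<in> hardy_functions" and g: "g \<in> hardy_functions"
  shows "(\<lambda>z. f z + g z) \<in> hardy_functions"
proof -
  have "summable (\<lambda>n. (cmod (taylor_coeff f n + taylor_coeff g n))\<^sup>2)"
  proof (rule summable_comparison_test')
    show "summable (\<lambda>n. 2 * (cmod (taylor_coeff f n))\<^sup>2 + 2 * (cmod (taylor_coeff g n))\<^sup>2)"
      using f g by (intro summable_add summable_mult) (auto simp: hardy_functions_def)
    fix n
    have "(cmod (taylor_coeff f n + taylor_coeff g n))\<^sup>2
        \<le> (cmod (taylor_coeff f n) + cmod (taylor_coeff g n))\<^sup>2"
      by (intro power_mono norm_triangle_ineq) auto
    also have "\<dots> \<le> 2 * (cmod (taylor_coeff f n))\<^sup>2 + 2 * (cmod (taylor_coeff g n))\<^sup>2"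
      using sum_squares_bound[of "cmod (taylor_coeff f n)" "cmod (taylor_coeff g n)"]
      by (simp add: power2_sum)
    finally show "norm ((cmod (taylor_coeff f n + taylor_coeff g n))\<^sup>2)
        \<le> 2 * (cmod (taylor_coeff f n))\<^sup>2 + 2 * (cmod (taylor_coeff g n))\<^sup>2" by simp
  qed
  then show ?thesis
    using f g by (auto simp: hardy_functions_def taylor_coeff_add intro!: holomorphic_intros)
qed

lemma hardy_cmult:
  assumes "f \<in> hardy_functions"
  shows "(\<lambda>z. c * f z) \<in> hardy_functions"
  using assms
  by (auto simp: hardy_functions_def taylor_coeff_cmult norm_mult power_mult_distrib
      intro!: holomorphic_intros summable_mult)

lemma hardy_shift:
  assumes "f \<in> hardy_functions"
  shows "(\<lambda>z. z * f z) \<in> hardy_functions"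
proof -
  have "summable (\<lambda>n. (cmod (taylor_coeff (\<lambda>z. z * f z) n))\<^sup>2)"
    using assms by (subst summable_Suc_iff[symmetric])
      (auto simp: hardy_functions_def taylor_coeff_shift)
  then show ?thesis
    using assms by (auto simp: hardy_functions_def intro!: holomorphic_intros)
qed

lemma hardy_const: "(\<lambda>z. if z \<in> ball 0 1 then c else 0) \<in> hardy_functions"
proof -
  have "(\<lambda>z. if z \<in> ball 0 1 then c else 0) holomorphic_on ball 0 1"
    by (rule holomorphic_transform[of "\<lambda>_. c"]) auto
  moreover have "summable (\<lambda>n. (cmod (if n = 0 then c else 0))\<^sup>2)"
    by (rule summable_finite[of "{0}"]) auto
  ultimately show ?thesis
    by (auto simp: hardy_functions_def taylor_coeff_const_disk simp del: mem_ball mem_ball_0)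
qed

typedef hardy = hardy_functions
  using hardy_zero by blast

setup_lifting type_definition_hardy

definition hcoeff :: "hardy \<Rightarrow> nat \<Rightarrow> complex"
  where "hcoeff f = taylor_coeff (Rep_hardy f)"

lemma Rep_hardy_holomorphic: "Rep_hardy f holomorphic_on ball 0 1"
  using Rep_hardy[of f] by (simp add: hardy_functions_def)

lemma hcoeff_summable: "summable (\<lambda>n. (cmod (hcoeff f n))\<^sup>2)"
  using Rep_hardy[of f] by (simp add: hardy_functions_def hcoeff_def)

lemma hardy_eqI:
  assumes "\<And>n. hcoeff f n = hcoeff g n"
  shows "f = g"
proof -
  have "Rep_hardy f z = Rep_hardy g z" for z
  proof (cases "z \<in> ball 0 1")
    case True
    then show ?thesis
      using holomorphic_eq_on_disk[OF Rep_hardy_holomorphic Rep_hardy_holomorphic, of f g]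
        assms[unfolded hcoeff_def] by blast
  next
    case False
    then show ?thesis
      using Rep_hardy[of f] Rep_hardy[of g] by (simp add: hardy_functions_def)
  qed
  then have "Rep_hardy f = Rep_hardy g" by (rule ext)
  then show ?thesis by (simp only: Rep_hardy_inject)
qed

lemma hcoeff_mult_summable: "summable (\<lambda>n. hcoeff f n * cnj (hcoeff g n))"
proof (rule summable_comparison_test')
  show "summable (\<lambda>n. (cmod (hcoeff f n))\<^sup>2 + (cmod (hcoeff g n))\<^sup>2)"
    by (intro summable_add hcoeff_summable)
  fix n
  have "2 * (cmod (hcoeff f n) * cmod (hcoeff g n)) \<le> (cmod (hcoeff f n))\<^sup>2 + (cmod (hcoeff g n))\<^sup>2"
    using sum_squares_bound[of "cmod (hcoeff f n)" "cmod (hcoeff g n)"] by simp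
  moreover have "0 \<le> cmod (hcoeff f n) * cmod (hcoeff g n)" by simp
  ultimately show "norm (hcoeff f n * cnj (hcoeff g n)) \<le> (cmod (hcoeff f n))\<^sup>2 + (cmod (hcoeff g n))\<^sup>2"
    unfolding norm_mult complex_mod_cnj by linarith
qed

instantiation hardy :: complex_inner
begin

lift_definition zero_hardy :: hardy is "\<lambda>_. 0"
  by (rule hardy_zero)

lift_definition plus_hardy :: "hardy \<Rightarrow> hardy \<Rightarrow> hardy" is "\<lambda>f g z. f z + g z"
  by (rule hardy_add)

lift_definition scaleC_hardy :: "complex \<Rightarrow> hardy \<Rightarrow> hardy" is "\<lambda>c f z. c * f z"
  by (rule hardy_cmult)

definition scaleR_hardy :: "real \<Rightarrow> hardy \<Rightarrow> hardy"
  where "r *\<^sub>R f = complex_of_real r *\<^sub>C f" for f :: hardy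

definition uminus_hardy :: "hardy \<Rightarrow> hardy"
  where "- f = (-1) *\<^sub>C f" for f :: hardy

definition minus_hardy :: "hardy \<Rightarrow> hardy \<Rightarrow> hardy"
  where "f - g = f + - g" for f g :: hardy

definition cinner_hardy :: "hardy \<Rightarrow> hardy \<Rightarrow> complex"
  where "cinner f g = (\<Sum>n. hcoeff f n * cnj (hcoeff g n))"

definition inner_hardy :: "hardy \<Rightarrow> hardy \<Rightarrow> real"
  where "inner f g = Re (cinner f g)" for f g :: hardy

definition norm_hardy :: "hardy \<Rightarrow> real"
  where "norm f = sqrt (inner f f)" for f :: hardy

definition dist_hardy :: "hardy \<Rightarrow> hardy \<Rightarrow> real"
  where "dist f g = norm (f - g)" for f g :: hardy

definition sgn_hardy :: "hardy \<Rightarrow> hardy"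
  where "sgn f = inverse (norm f) *\<^sub>R f" for f :: hardy

definition uniformity_hardy :: "(hardy \<times> hardy) filter"
  where "uniformity_hardy = (INF e\<in>{0<..}. principal {(f, g). dist f g < e})"

definition open_hardy :: "hardy set \<Rightarrow> bool"
  where "open_hardy U \<longleftrightarrow> (\<forall>f\<in>U. \<forall>\<^sub>F (f', g) in uniformity. f' = f \<longrightarrow> g \<in> U)"

instance
proof
  have coeff_add: "hcoeff (f + g) n = hcoeff f n + hcoeff g n" for f g n
    by (simp add: hcoeff_def plus_hardy.rep_eq taylor_coeff_add Rep_hardy_holomorphic)
  have coeff_cmult: "hcoeff (c *\<^sub>C f) n = c * hcoeff f n" for c f n
    by (simp add: hcoeff_def scaleC_hardy.rep_eq taylor_coeff_cmult Rep_hardy_holomorphic)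
  have coeff_0: "hcoeff 0 n = 0" for n
    using taylor_coeff_eqI[OF has_fps_expansion_0] by (simp add: hcoeff_def zero_hardy.rep_eq)
  note coeffs = coeff_add coeff_cmult coeff_0 minus_hardy_def uminus_hardy_def scaleR_hardy_def
  fix f g h :: hardy and r s :: real and c d :: complex
  show "f + g + h = f + (g + h)" "f + g = g + f" "0 + f = f" "- f + f = 0" "f - g = f + - g"
    "r *\<^sub>R (f + g) = r *\<^sub>R f + r *\<^sub>R g" "(r + s) *\<^sub>R f = r *\<^sub>R f + s *\<^sub>R f"
    "r *\<^sub>R s *\<^sub>R f = (r * s) *\<^sub>R f" "1 *\<^sub>R f = f"
    "c *\<^sub>C (f + g) = c *\<^sub>C f + c *\<^sub>C g" "(c + d) *\<^sub>C f = c *\<^sub>C f + d *\<^sub>C f"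
    "c *\<^sub>C d *\<^sub>C f = (c * d) *\<^sub>C f" "complex_of_real r *\<^sub>C f = r *\<^sub>R f"
    by (rule hardy_eqI; simp add: coeffs algebra_simps)+
  show "sgn f = inverse (norm f) *\<^sub>R f" by (fact sgn_hardy_def)
  show "dist f g = norm (f - g)" by (fact dist_hardy_def)
  show "(uniformity :: (hardy \<times> hardy) filter)
      = (INF e\<in>{0<..}. principal {(f, g). dist f g < e})"
    by (fact uniformity_hardy_def)
  show "open U \<longleftrightarrow> (\<forall>f\<in>U. \<forall>\<^sub>F (f', g) in uniformity. f' = f \<longrightarrow> g \<in> U)" for U :: "hardy set"
    by (fact open_hardy_def)
  show "norm f = sqrt (inner f f)" by (fact norm_hardy_def)
  show "Re (cinner f g) = inner f g" by (simp add: inner_hardy_def)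
  show comm: "cinner f g = cnj (cinner g f)" for f g :: hardy
    unfolding cinner_hardy_def bounded_linear.suminf[OF bounded_linear_cnj hcoeff_mult_summable]
    by (simp add: mult.commute)
  show add: "cinner (f + g) h = cinner f h + cinner g h" for f g h :: hardy
    unfolding cinner_hardy_def suminf_add[OF hcoeff_mult_summable hcoeff_mult_summable]
    by (simp add: coeffs distrib_right)
  show scale: "cinner (c *\<^sub>C f) g = c * cinner f g" for c and f g :: hardy
    unfolding cinner_hardy_def suminf_mult[OF hcoeff_mult_summable, symmetric]
    by (simp add: coeffs mult.assoc)
  show "inner f g = inner g f"
    unfolding inner_hardy_def by (metis comm cnj.sel(1))
  show "inner (f + g) h = inner f h + inner g h" by (simp add: inner_hardy_def add)
  show "inner (r *\<^sub>R f) g = r * inner f g" by (simp add: inner_hardy_def scaleR_hardy_def scale)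
  have "cinner f f = (\<Sum>n. complex_of_real ((cmod (hcoeff f n))\<^sup>2))"
    by (simp only: cinner_hardy_def complex_norm_square)
  then have eq: "inner f f = (\<Sum>n. (cmod (hcoeff f n))\<^sup>2)"
    by (simp only: inner_hardy_def suminf_of_real[OF hcoeff_summable, symmetric] Re_complex_of_real)
  show "0 \<le> inner f f" unfolding eq by (simp add: suminf_nonneg hcoeff_summable)
  have "inner f f = 0 \<longleftrightarrow> (\<forall>n. (cmod (hcoeff f n))\<^sup>2 = 0)"
    unfolding eq by (rule suminf_eq_zero_iff[OF hcoeff_summable zero_le_power2])
  also have "\<dots> \<longleftrightarrow> (\<forall>n. hcoeff f n = hcoeff 0 n)" by (simp add: coeff_0)
  also have "\<dots> \<longleftrightarrow> f = 0" using hardy_eqI[of f 0] by blast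
  finally show "inner f f = 0 \<longleftrightarrow> f = 0" .
qed

end

lift_definition shift :: "hardy \<Rightarrow> hardy" is "\<lambda>f z. z * f z"
  by (rule hardy_shift)

lift_definition const_hardy :: "complex \<Rightarrow> hardy" is "\<lambda>c z. if z \<in> ball 0 1 then c else 0"
  by (rule hardy_const)

definition constants :: "hardy set"
  where "constants = range const_hardy"

definition zH2 :: "hardy set"
  where "zH2 = range shift"

lemma hcoeff_shift: "hcoeff (shift f) n = (case n of 0 \<Rightarrow> 0 | Suc m \<Rightarrow> hcoeff f m)"
  by (simp add: hcoeff_def shift.rep_eq taylor_coeff_shift Rep_hardy_holomorphic split: nat.split)

lemma hcoeff_const: "hcoeff (const_hardy c) n = (if n = 0 then c else 0)"
  by (simp only: hcoeff_def const_hardy.rep_eq taylor_coeff_const_disk)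

end

theory Submission
  imports Defs
begin

text \<open>Since \<open>(S \<oplus> S\<^sup>*)\<^sup>* = S\<^sup>* \<oplus> S\<close>, the equation says that \<open>(S \<oplus> S\<^sup>*) Y\<close> is self-adjoint, i.e. that \<open>S Y\<^sub>1\<^sub>1\<close>
  and \<open>S\<^sup>* Y\<^sub>2\<^sub>2\<close> are self-adjoint and \<open>S Y\<^sub>1\<^sub>2 = Y\<^sub>2\<^sub>1\<^sup>* S\<close>. The first condition forces \<open>Y\<^sub>1\<^sub>1 1 = 0\<close>, whence
  \<open>Y\<^sub>1\<^sub>1 = (Y\<^sub>1\<^sub>1 S) S\<^sup>*\<close> with \<open>Y\<^sub>1\<^sub>1 S\<close> self-adjoint. The second gives \<open>Y\<^sub>2\<^sub>2 = P Y\<^sub>2\<^sub>2 + S (S\<^sup>* Y\<^sub>2\<^sub>2)\<close>. The third forces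
  \<open>Y\<^sub>2\<^sub>1 1\<close> to be orthogonal to \<open>zH\<^sup>2\<close> and gives \<open>Y\<^sub>1\<^sub>2 = S\<^sup>* Y\<^sub>2\<^sub>1\<^sup>* S\<close>.\<close>

section \<open>Adjoints in complex inner product spaces\<close>

lemma cinner_add_right: "cinner x (y + z) = cinner x y + cinner x (z :: 'a :: complex_inner)"
  by (metis cinner_commute cinner_add_left complex_cnj_add)

lemma cinner_scaleC_right: "cinner x (c *\<^sub>C y) = cnj c * cinner x (y :: 'a :: complex_inner)"
  by (metis cinner_commute cinner_scaleC_left complex_cnj_mult)

lemma scaleC_zero_right [simp]: "c *\<^sub>C 0 = (0 :: 'a :: complex_inner)"
  using scaleC_add_right[of c 0 "0::'a"] by simp

lemma cinner_zero_left [simp]: "cinner 0 (y :: 'a :: complex_inner) = 0"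
  using cinner_add_left[of 0 0 y] by simp

lemma cinner_zero_right [simp]: "cinner (y :: 'a :: complex_inner) 0 = 0"
  using cinner_add_right[of y 0 0] by simp

lemma cinner_diff_right: "cinner x (y - z) = cinner x y - cinner x (z :: 'a :: complex_inner)"
  using cinner_add_right[of x "y - z" z] by simp

lemma cinner_self_eq_0_iff [simp]: "cinner x x = 0 \<longleftrightarrow> x = (0 :: 'a :: complex_inner)"
  using Re_cinner[of x x] by (metis cinner_zero_left inner_eq_zero_iff zero_complex.sel(1))

lemma cinner_ext:
  fixes x y :: "'a :: complex_inner"
  assumes "\<And>u. cinner u x = cinner u y"
  shows "x = y"
  using assms[of "x - y"] cinner_self_eq_0_iff[of "x - y"]
  by (simp add: cinner_diff_right del: cinner_self_eq_0_iff)

text \<open>The real Cauchy-Schwarz inequality controls only the real part, so \<open>x\<close> is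
  first rotated until the inner product equals its own modulus.\<close>

lemma norm_cinner_le: "norm (cinner x y) \<le> norm x * norm (y :: 'a :: complex_inner)"
proof -
  \<comment> \<open>Since \<open>sgn 0 = 0\<close>, the factor vanishes when the inner product does;
    hence \<open>cmod c \<le> 1\<close> below instead of equality.\<close>
  define c where "c = cnj (sgn (cinner x y))"
  have "c * cinner x y = complex_of_real (cmod (cinner x y))"
    by (auto simp: c_def sgn_eq complex_norm_square[symmetric] power2_eq_square mult.commute
        divide_simps)
  then have "cmod (cinner x y) = Re (cinner (c *\<^sub>C x) y)"
    by (simp add: cinner_scaleC_left)
  also have "\<dots> \<le> norm (c *\<^sub>C x) * norm y"
    by (simp add: Re_cinner norm_cauchy_schwarz)
  also have "norm (c *\<^sub>C x) \<le> norm x"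
  proof (rule power2_le_imp_le)
    have "cinner (c *\<^sub>C x) (c *\<^sub>C x) = of_real ((cmod c)\<^sup>2) * cinner x x"
      by (simp only: cinner_scaleC_left cinner_scaleC_right complex_norm_square mult_ac)
    then have "(norm (c *\<^sub>C x))\<^sup>2 = (cmod c)\<^sup>2 * (norm x)\<^sup>2"
      by (metis Re_cinner Re_complex_of_real power2_norm_eq_inner times_complex.sel(1)
          Im_complex_of_real diff_zero mult_zero_left)
    moreover have "cmod c \<le> 1" by (simp add: c_def norm_sgn)
    ultimately show "(norm (c *\<^sub>C x))\<^sup>2 \<le> (norm x)\<^sup>2"
      by (simp add: mult_left_le_one_le power_le_one)
  qed simp
  finally show ?thesis by (simp add: mult_right_mono)
qed

text \<open>The Riesz representation property stands in for completeness: it is what makes the description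
  in \<^const>\<open>adjoint_on\<close> proper, and it transfers along the shift to \<^const>\<open>zH2\<close>.\<close>

definition riesz_space :: "'a::complex_inner set \<Rightarrow> bool" where
  "riesz_space M \<longleftrightarrow> (\<forall>x\<in>M. \<forall>y\<in>M. x - y \<in> M) \<and>
     (\<forall>\<phi>. (\<forall>x\<in>M. \<forall>y\<in>M. \<phi> (x + y) = \<phi> x + \<phi> y) \<and> (\<forall>c. \<forall>x\<in>M. \<phi> (c *\<^sub>C x) = c * \<phi> x) \<and>
        (\<exists>K. \<forall>x\<in>M. cmod (\<phi> x) \<le> K * norm x) \<longrightarrow>
      (\<exists>y\<in>M. \<forall>x\<in>M. \<phi> x = cinner x y))"

lemma riesz_spaceD:
  assumes "riesz_space M"
    and "\<And>x y. x \<in> M \<Longrightarrow> y \<in> M \<Longrightarrow> \<phi> (x + y) = \<phi> x + \<phi> y"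
    and "\<And>c x. x \<in> M \<Longrightarrow> \<phi> (c *\<^sub>C x) = c * \<phi> x"
    and "\<And>x. x \<in> M \<Longrightarrow> cmod (\<phi> x) \<le> K * norm x"
  obtains y where "y \<in> M" "\<And>x. x \<in> M \<Longrightarrow> \<phi> x = cinner x y"
  using assms unfolding riesz_space_def by metis

text \<open>Two candidates differ by a vector of \<open>M\<close>, and testing with that very vector
  shows that it is orthogonal to itself.\<close>

lemma adjoint_on_eqI:
  assumes M: "riesz_space M" and x: "x \<in> M" and eq: "\<And>u. u \<in> M \<Longrightarrow> cinner (T u) y = cinner u x"
  shows "adjoint_on M N T y = x"
  unfolding adjoint_on_def
proof (rule the_equality)
  fix x' assume x': "x' \<in> M \<and> (\<forall>u\<in>M. cinner (T u) y = cinner u x')"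
  then have "x' - x \<in> M" using M x by (simp add: riesz_space_def)
  then have "cinner (x' - x) (x' - x) = 0"
    using x' eq[of "x' - x"] by (simp add: cinner_diff_right)
  then show "x' = x" by simp
qed (use x eq in auto)

text \<open>By Cauchy-Schwarz the functional \<open>\<lambda>u. cinner (T u) y\<close> has bound
  \<open>K * norm y\<close>, so a representing vector exists, and by uniqueness it is the one
  described.\<close>

lemma adjoint_on:
  assumes M: "riesz_space M" and T: "T \<in> bounded_ops M N"
  shows "adjoint_on M N T y \<in> M"
    and "u \<in> M \<Longrightarrow> cinner (T u) y = cinner u (adjoint_on M N T y)"
proof -
  obtain K where K: "\<And>x. x \<in> M \<Longrightarrow> norm (T x) \<le> K * norm x"
    using T unfolding bounded_ops_def by blast
  obtain x where x: "x \<in> M" "\<And>u. u \<in> M \<Longrightarrow> cinner (T u) y = cinner u x"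
  proof (rule riesz_spaceD[OF M, of "\<lambda>u. cinner (T u) y" "K * norm y"])
    fix u assume "u \<in> M"
    have "cmod (cinner (T u) y) \<le> norm (T u) * norm y" by (rule norm_cinner_le)
    also have "\<dots> \<le> K * norm u * norm y" using K[OF \<open>u \<in> M\<close>] by (simp add: mult_right_mono)
    finally show "cmod (cinner (T u) y) \<le> K * norm y * norm u" by (simp add: mult_ac)
  qed (use T in \<open>auto simp: bounded_ops_def cinner_add_left cinner_scaleC_left\<close>)
  have "adjoint_on M N T y = x" using M x by (rule adjoint_on_eqI)
  then show "adjoint_on M N T y \<in> M"
    and "u \<in> M \<Longrightarrow> cinner (T u) y = cinner u (adjoint_on M N T y)"
    using x by auto
qed

text \<open>Replaces the description operator hidden in \<open>adj\<close> by symmetry, the form in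
  which self-adjointness is proved and used below.\<close>

lemma selfadjoint_op_iff:
  assumes "riesz_space (UNIV :: 'a::complex_inner set)"
  shows "selfadjoint_op (A :: 'a \<Rightarrow> 'a) \<longleftrightarrow>
    A \<in> bounded_ops UNIV UNIV \<and> (\<forall>x y. cinner (A x) y = cinner x (A y))"
proof
  assume "selfadjoint_op A"
  then show "A \<in> bounded_ops UNIV UNIV \<and> (\<forall>x y. cinner (A x) y = cinner x (A y))"
    using adjoint_on(2)[OF assms, of A UNIV] by (auto simp: selfadjoint_op_def)
next
  assume "A \<in> bounded_ops UNIV UNIV \<and> (\<forall>x y. cinner (A x) y = cinner x (A y))"
  then show "selfadjoint_op A"
    by (auto simp: selfadjoint_op_def intro!: ext adjoint_on_eqI[OF assms])
qed

text \<open>A functional is the sum of its restrictions to the two coordinate axes; the embeddings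
  are isometric, so each restriction has its own representing vector.\<close>

lemma riesz_space_prod:
  assumes "riesz_space (UNIV :: 'a::complex_inner set)" "riesz_space (UNIV :: 'b::complex_inner set)"
  shows "riesz_space (UNIV :: ('a \<times> 'b) set)"
  unfolding riesz_space_def
proof (intro conjI allI impI; (elim conjE exE)?)
  fix \<phi> :: "'a \<times> 'b \<Rightarrow> complex" and K
  assume add: "\<forall>x\<in>UNIV. \<forall>y\<in>UNIV. \<phi> (x + y) = \<phi> x + \<phi> y"
    and scale: "\<forall>c. \<forall>x\<in>UNIV. \<phi> (c *\<^sub>C x) = c * \<phi> x"
    and K: "\<forall>x\<in>UNIV. cmod (\<phi> x) \<le> K * norm x"
  obtain a where a: "\<And>x. \<phi> (x, 0) = cinner x a"
  proof (rule riesz_spaceD[OF assms(1), of "\<lambda>x. \<phi> (x, 0)" K])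
    fix x y :: 'a and c
    show "\<phi> (x + y, 0) = \<phi> (x, 0) + \<phi> (y, 0)"
      using add[rule_format, of "(x, 0)" "(y, 0)"] by simp
    show "\<phi> (c *\<^sub>C x, 0) = c * \<phi> (x, 0)"
      using scale[rule_format, of "(x, 0)" c] by (simp add: scaleC_prod_def)
    show "cmod (\<phi> (x, 0)) \<le> K * norm x"
      using K[rule_format, of "(x, 0)"] by (simp add: norm_Pair)
  qed auto
  obtain b where b: "\<And>x. \<phi> (0, x) = cinner x b"
  proof (rule riesz_spaceD[OF assms(2), of "\<lambda>x. \<phi> (0, x)" K])
    fix x y :: 'b and c
    show "\<phi> (0, x + y) = \<phi> (0, x) + \<phi> (0, y)"
      using add[rule_format, of "(0, x)" "(0, y)"] by simp
    show "\<phi> (0, c *\<^sub>C x) = c * \<phi> (0, x)"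
      using scale[rule_format, of "(0, x)" c] by (simp add: scaleC_prod_def)
    show "cmod (\<phi> (0, x)) \<le> K * norm x"
      using K[rule_format, of "(0, x)"] by (simp add: norm_Pair)
  qed auto
  have "\<phi> p = cinner p (a, b)" for p
    using add[rule_format, of "(fst p, 0)" "(0, snd p)"] a b by (simp add: cinner_prod_def)
  then show "\<exists>y\<in>UNIV. \<forall>x\<in>UNIV. \<phi> x = cinner x y" by blast
qed auto

section \<open>Coefficients and the Riesz property of the Hardy space\<close>

lemma hcoeff_add: "hcoeff (f + g) n = hcoeff f n + hcoeff g n"
  by (simp add: hcoeff_def plus_hardy.rep_eq taylor_coeff_add Rep_hardy_holomorphic)

lemma hcoeff_scaleC: "hcoeff (c *\<^sub>C f) n = c * hcoeff f n"
  by (simp add: hcoeff_def scaleC_hardy.rep_eq taylor_coeff_cmult Rep_hardy_holomorphic)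

lemma hcoeff_zero [simp]: "hcoeff 0 n = 0"
  using hcoeff_add[of 0 0 n] by simp

lemma hcoeff_diff: "hcoeff (f - g) n = hcoeff f n - hcoeff g n"
  using hcoeff_add[of "f - g" g n] by simp

lemma norm_hardy_power2: "(norm f)\<^sup>2 = (\<Sum>n. (cmod (hcoeff f n))\<^sup>2)"
proof -
  have "cinner f f = (\<Sum>n. complex_of_real ((cmod (hcoeff f n))\<^sup>2))"
    by (simp only: cinner_hardy_def complex_norm_square)
  then show ?thesis
    unfolding power2_norm_eq_inner[of f] Re_cinner[symmetric]
    by (simp only: suminf_of_real[OF hcoeff_summable, symmetric] Re_complex_of_real)
qed

text \<open>Identifies the space with square-summable sequences: such a sequence is bounded, so a
  geometric series dominates its power series at each point of the disk.\<close>

lemma hardy_of_coeffs: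
  assumes a: "summable (\<lambda>n. (cmod (a n))\<^sup>2)"
  obtains f where "\<And>n. hcoeff f n = a n"
proof -
  have "(\<lambda>n. cmod (a n)) \<longlonglongrightarrow> 0"
    using tendsto_real_sqrt[OF summable_LIMSEQ_zero[OF a]] by simp
  then have "Bseq (\<lambda>n. cmod (a n))" by (intro convergent_imp_Bseq) (auto simp: convergent_def)
  then obtain C where C: "\<And>n. cmod (a n) \<le> C" by (auto simp: Bseq_def)
  have sm: "summable (\<lambda>n. a n * z ^ n)" if z: "z \<in> ball 0 1" for z
  proof (rule summable_comparison_test')
    show "summable (\<lambda>n. C * cmod z ^ n)" using z by (intro summable_mult summable_geometric) auto
    show "norm (a n * z ^ n) \<le> C * cmod z ^ n" for n
      using C[of n] by (simp add: norm_mult norm_power mult_right_mono)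
  qed
  define F where "F z = (if z \<in> ball 0 1 then \<Sum>n. a n * z ^ n else 0)" for z :: complex
  have sums: "(\<lambda>n. a n * z ^ n) sums F z" if "z \<in> ball 0 1" for z
    using summable_sums[OF sm[OF that]] that by (simp only: F_def if_True)
  have hol: "F holomorphic_on ball 0 1"
    using power_series_holomorphic[of 0 1 a F] sums by simp
  have "F has_fps_expansion Abs_fps a"
  proof (rule has_fps_expansionI)
    show "\<forall>\<^sub>F u in nhds 0. (\<lambda>n. fps_nth (Abs_fps a) n * u ^ n) sums F u"
      using sums by (intro eventually_nhds_in_open[of "ball 0 1", THEN eventually_mono]) auto
  qed
  then have coeff: "taylor_coeff F n = a n" for n using taylor_coeff_eqI by force
  have "F \<in> hardy_functions"
    using hol a by (auto simp: hardy_functions_def coeff F_def)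
  then have "hcoeff (Abs_hardy F) n = a n" for n by (simp add: hcoeff_def coeff Abs_hardy_inverse)
  then show ?thesis by (rule that)
qed

lemma hardy_of_finite_coeffs:
  obtains f where "\<And>n. hcoeff f n = (if n < N then a n else 0)"
proof (rule hardy_of_coeffs)
  show "summable (\<lambda>n. (cmod (if n < N then a n else 0))\<^sup>2)"
    by (rule summable_finite[of "{..<N}"]) auto
qed (rule that)

text \<open>Riesz representation done by hand in coefficients: the values on the monomials determine
  the functional on polynomials, their conjugates are square summable, and polynomials are
  dense.\<close>

lemma riesz_space_hardy: "riesz_space (UNIV :: hardy set)"
  unfolding riesz_space_def
proof (intro conjI allI impI; (elim conjE exE)?)
  fix \<phi> :: "hardy \<Rightarrow> complex" and K
  assume add: "\<forall>x\<in>UNIV. \<forall>y\<in>UNIV. \<phi> (x + y) = \<phi> x + \<phi> y"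
    and scale: "\<forall>c. \<forall>x\<in>UNIV. \<phi> (c *\<^sub>C x) = c * \<phi> x"
    and K: "\<forall>x\<in>UNIV. cmod (\<phi> x) \<le> K * norm x"
  have "\<exists>e. \<forall>k. hcoeff e k = (if k = n then 1 else 0)" for n
  proof -
    have "summable (\<lambda>k. (cmod (if k = n then 1 else 0))\<^sup>2)"
      by (rule summable_finite[of "{n}"]) auto
    then show ?thesis by (rule hardy_of_coeffs) blast
  qed
  then obtain e where e: "\<And>n k. hcoeff (e n) k = (if k = n then 1 else 0)" by metis
  define b where "b n = \<phi> (e n)" for n
  \<comment> \<open>Linearity alone handles polynomials: the top coefficient is split off in each
    induction step.\<close>
  have poly: "\<phi> f = (\<Sum>n<N. hcoeff f n * b n)" if "\<And>n. n \<ge> N \<Longrightarrow> hcoeff f n = 0" for f N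
    using that
  proof (induction N arbitrary: f)
    case 0
    then have "f = 0" by (intro hardy_eqI) simp
    then show ?case using add[rule_format, of 0 0] by simp
  next
    case (Suc N)
    define g where "g = f - hcoeff f N *\<^sub>C e N"
    have g: "hcoeff g n = (if n = N then 0 else hcoeff f n)" for n
      by (simp add: g_def hcoeff_diff hcoeff_scaleC e)
    have "\<phi> f = \<phi> (g + hcoeff f N *\<^sub>C e N)" by (simp add: g_def)
    also have "\<dots> = \<phi> g + hcoeff f N * b N" using add scale by (simp add: b_def)
    also have "\<phi> g = (\<Sum>n<N. hcoeff g n * b n)"
      using Suc.prems by (intro Suc.IH) (auto simp: g)
    also have "\<dots> = (\<Sum>n<N. hcoeff f n * b n)" by (simp add: g)
    finally show ?case by simp
  qed
  \<comment> \<open>The test vector has coefficients \<open>cnj (b n)\<close> for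
    \<open>n < N\<close>, so that \<open>\<phi> f\<close> equals the squared norm of
    \<open>f\<close>.\<close>
  have bound: "(\<Sum>n<N. (cmod (b n))\<^sup>2) \<le> K\<^sup>2" for N
  proof -
    define s where "s = (\<Sum>n<N. (cmod (b n))\<^sup>2)"
    obtain f where f: "\<And>n. hcoeff f n = (if n < N then cnj (b n) else 0)"
      by (rule hardy_of_finite_coeffs[of N "\<lambda>n. cnj (b n)"]) blast
    have "\<phi> f = (\<Sum>n<N. of_real ((cmod (b n))\<^sup>2))"
      by (subst poly[of N])
        (auto simp: f complex_norm_square mult.commute simp del: of_real_power intro!: sum.cong)
    then have "\<phi> f = of_real s" by (simp add: s_def)
    moreover have nf: "(norm f)\<^sup>2 = s"
      unfolding norm_hardy_power2 s_def by (subst suminf_finite[of "{..<N}"]) (auto simp: f)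
    ultimately have "s \<le> K * norm f" using K[rule_format, of f] by simp
    then have le: "(norm f)\<^sup>2 \<le> K * norm f" by (simp add: nf)
    have "(norm f)\<^sup>2 \<le> K\<^sup>2"
    \<comment> \<open>\<open>K\<close> may be negative, so squaring comes after cancelling a nonzero
      \<open>norm f\<close>, which leaves \<open>norm f \<le> K\<close> with a nonnegative left
      side.\<close>
    proof (cases "norm f = 0")
      case False
      then have "0 \<le> norm f" "norm f \<le> K" using le by (auto simp: power2_eq_square)
      then show ?thesis by (rule power_mono[rotated])
    qed (simp del: norm_eq_zero)
    then show ?thesis by (simp add: nf s_def)
  qed
  have "summable (\<lambda>n. (cmod (cnj (b n)))\<^sup>2)"
    using bound by (intro bounded_imp_summable[of _ "K\<^sup>2"])
      (auto simp: lessThan_Suc_atMost[symmetric] simp del: sum.lessThan_Suc)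
  \<comment> \<open>The conjugate compensates for the conjugate-linearity of \<open>cinner\<close>
    in its second argument.\<close>
  then obtain y where y: "\<And>n. hcoeff y n = cnj (b n)" by (rule hardy_of_coeffs) blast
  have "\<phi> x = cinner x y" for x
  proof -
    have "\<exists>t. \<forall>n. hcoeff t n = (if n < N then hcoeff x n else 0)" for N
      by (metis hardy_of_finite_coeffs)
    then obtain t where t: "\<And>N n. hcoeff (t N) n = (if n < N then hcoeff x n else 0)" by metis
    \<comment> \<open>The error of truncating to degree below \<open>N\<close> is a tail of the
      convergent series for the norm, hence tends to 0.\<close>
    have tail: "(norm (x - t N))\<^sup>2 = (\<Sum>n. (cmod (hcoeff x n))\<^sup>2) - (\<Sum>n<N. (cmod (hcoeff x n))\<^sup>2)"
      for N
    proof -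
      have "(norm (x - t N))\<^sup>2 = (\<Sum>n. (cmod (hcoeff (x - t N) (n + N)))\<^sup>2)"
        unfolding norm_hardy_power2
        by (subst suminf_split_initial_segment[OF hcoeff_summable, where k = N])
          (simp add: hcoeff_diff t)
      also have "\<dots> = (\<Sum>n. (cmod (hcoeff x (n + N)))\<^sup>2)" by (simp add: hcoeff_diff t)
      finally show ?thesis by (simp add: suminf_minus_initial_segment[OF hcoeff_summable])
    qed
    have "(\<lambda>N. (norm (x - t N))\<^sup>2) \<longlonglongrightarrow> 0"
      unfolding tail
      using tendsto_diff[OF tendsto_const[of "\<Sum>n. (cmod (hcoeff x n))\<^sup>2"]
          summable_LIMSEQ[OF hcoeff_summable[of x]]] by simp
    then have "(\<lambda>N. norm (x - t N)) \<longlonglongrightarrow> 0"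
      using tendsto_real_sqrt by fastforce
    then have "(\<lambda>N. K * norm (x - t N)) \<longlonglongrightarrow> 0" using tendsto_mult_right_zero by blast
    then have "(\<lambda>N. \<phi> x - \<phi> (t N)) \<longlonglongrightarrow> 0"
    proof (rule Lim_null_comparison[rotated], intro always_eventually allI)
      fix N
      have "\<phi> x - \<phi> (t N) = \<phi> (x - t N)" using add[rule_format, of "x - t N" "t N"] by simp
      then show "norm (\<phi> x - \<phi> (t N)) \<le> K * norm (x - t N)" using K by simp
    qed
    then have "(\<lambda>N. \<phi> (t N)) \<longlonglongrightarrow> \<phi> x"
      using tendsto_diff[OF tendsto_const[of "\<phi> x"]] by fastforce
    moreover have "\<phi> (t N) = (\<Sum>n<N. hcoeff x n * cnj (hcoeff y n))" for N
      by (subst poly[of N]) (auto simp: t y)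
    ultimately have "(\<lambda>n. hcoeff x n * cnj (hcoeff y n)) sums \<phi> x" by (simp add: sums_def)
    then show ?thesis by (simp add: cinner_hardy_def sums_iff)
  qed
  then show "\<exists>y\<in>UNIV. \<forall>x\<in>UNIV. \<phi> x = cinner x y" by blast
qed auto

section \<open>The shift and its adjoint\<close>

lemma shift_add: "shift (x + y) = shift x + shift y"
  by (rule hardy_eqI) (simp add: hcoeff_shift hcoeff_add split: nat.split)

lemma shift_scaleC: "shift (c *\<^sub>C x) = c *\<^sub>C shift x"
  by (rule hardy_eqI) (simp add: hcoeff_shift hcoeff_scaleC split: nat.split)

lemma shift_diff: "shift (x - y) = shift x - shift y"
  by (rule hardy_eqI) (simp add: hcoeff_shift hcoeff_diff split: nat.split)

lemma cinner_split: "cinner x y = hcoeff x 0 * cnj (hcoeff y 0)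
    + (\<Sum>n. hcoeff x (Suc n) * cnj (hcoeff y (Suc n)))"
  unfolding cinner_hardy_def by (subst suminf_split_head[OF hcoeff_mult_summable]) simp

text \<open>The adjoint is the backward shift: coefficient 0 of \<open>shift u\<close> vanishes, so
  the inner product with \<open>f\<close> sees only the later coefficients of
  \<open>f\<close>.\<close>

lemma hcoeff_adj_shift: "hcoeff (adj shift f) n = hcoeff f (Suc n)"
proof -
  have "summable (\<lambda>n. (cmod (hcoeff f (Suc n)))\<^sup>2)"
    using hcoeff_summable[of f] by (subst summable_Suc_iff)
  then obtain g where g: "\<And>n. hcoeff g n = hcoeff f (Suc n)" by (rule hardy_of_coeffs) blast
  have "adj shift f = g"
  proof (rule adjoint_on_eqI[OF riesz_space_hardy])
    show "cinner (shift u) f = cinner u g" for u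
      unfolding cinner_split[of "shift u"] cinner_hardy_def[of u] by (simp add: hcoeff_shift g)
  qed simp
  then show ?thesis by (simp add: g)
qed

lemma adj_shift_shift [simp]: "adj shift (shift f) = f"
  by (rule hardy_eqI) (simp add: hcoeff_adj_shift hcoeff_shift)

lemma cinner_shift_left: "cinner (shift x) y = cinner x (adj shift y)"
  unfolding cinner_split[of "shift x"] cinner_hardy_def[of x]
  by (simp add: hcoeff_shift hcoeff_adj_shift)

lemma cinner_shift_right: "cinner x (shift y) = cinner (adj shift x) y"
  by (metis cinner_commute cinner_shift_left)

lemma norm_shift [simp]: "norm (shift f) = norm f"
  by (simp add: norm_eq_sqrt_cinner cinner_shift_left)

lemma norm_adj_shift_le: "norm (adj shift f) \<le> norm f"
proof (rule power2_le_imp_le)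
  have "(norm (adj shift f))\<^sup>2 = (norm f)\<^sup>2 - (cmod (hcoeff f 0))\<^sup>2"
    unfolding norm_hardy_power2 by (simp add: hcoeff_adj_shift suminf_split_head[OF hcoeff_summable])
  then show "(norm (adj shift f))\<^sup>2 \<le> (norm f)\<^sup>2" by simp
qed simp

lemma adj_shift_add: "adj shift (x + y) = adj shift x + adj shift y"
  by (rule hardy_eqI) (simp add: hcoeff_adj_shift hcoeff_add)

lemma adj_shift_scaleC: "adj shift (c *\<^sub>C x) = c *\<^sub>C adj shift x"
  by (rule hardy_eqI) (simp add: hcoeff_adj_shift hcoeff_scaleC)

lemma adj_shift_const [simp]: "adj shift (const_hardy c) = 0"
  by (rule hardy_eqI) (simp add: hcoeff_adj_shift hcoeff_const)

text \<open>This is I = P + S S*, with P the projection onto the constants; every decomposition of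
  an operator below rests on it.\<close>

lemma const_plus_shift: "const_hardy (hcoeff f 0) + shift (adj shift f) = f"
  by (rule hardy_eqI) (simp add: hcoeff_add hcoeff_adj_shift hcoeff_const hcoeff_shift split: nat.split)

lemma const_hardy_add: "const_hardy (a + b) = const_hardy a + const_hardy b"
  by (rule hardy_eqI) (simp add: hcoeff_add hcoeff_const)

lemma const_hardy_mult: "const_hardy (c * a) = c *\<^sub>C const_hardy a"
  by (rule hardy_eqI) (simp add: hcoeff_scaleC hcoeff_const)

lemma norm_const_hardy: "norm (const_hardy c) = cmod c"
proof -
  have "(norm (const_hardy c))\<^sup>2 = (cmod c)\<^sup>2"
    unfolding norm_hardy_power2 by (subst suminf_finite[of "{0}"]) (auto simp: hcoeff_const)
  then show ?thesis by simp
qed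

lemma norm_hcoeff_le: "cmod (hcoeff f n) \<le> norm f"
proof (rule power2_le_imp_le)
  show "(cmod (hcoeff f n))\<^sup>2 \<le> (norm f)\<^sup>2"
    unfolding norm_hardy_power2 using sum_le_suminf[OF hcoeff_summable[of f], of "{n}"] by simp
qed simp

text \<open>The remainder lies in the range of the shift, and S* annihilates constants; uniqueness
  follows by testing with the constant 1.\<close>

lemma ortho_proj_constants: "ortho_proj constants f = const_hardy (hcoeff f 0)"
  unfolding ortho_proj_def
proof (rule the_equality)
  have "f - const_hardy (hcoeff f 0) = shift (adj shift f)"
    by (metis add_diff_cancel_left' const_plus_shift)
  then show "const_hardy (hcoeff f 0) \<in> constants \<and>
      (\<forall>u\<in>constants. cinner (f - const_hardy (hcoeff f 0)) u = 0)"
    by (auto simp: constants_def cinner_shift_left)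
next
  fix y assume y: "y \<in> constants \<and> (\<forall>u\<in>constants. cinner (f - y) u = 0)"
  then obtain c where c: "y = const_hardy c" by (auto simp: constants_def)
  have "cinner (f - y) (const_hardy 1) = 0" using y by (auto simp: constants_def)
  then show "y = const_hardy (hcoeff f 0)"
    by (simp add: cinner_split c hcoeff_diff hcoeff_const)
qed

text \<open>The shift is an isometry onto \<open>zH2\<close>: pull the functional back to the whole
  space, represent it there and shift the representing vector.\<close>

lemma riesz_space_zH2: "riesz_space zH2"
  unfolding riesz_space_def
proof (intro conjI allI impI; (elim conjE exE)?)
  show "\<forall>x\<in>zH2. \<forall>y\<in>zH2. x - y \<in> zH2" by (auto simp: zH2_def simp flip: shift_diff)
  fix \<phi> :: "hardy \<Rightarrow> complex" and K
  assume *: "\<forall>x\<in>zH2. \<forall>y\<in>zH2. \<phi> (x + y) = \<phi> x + \<phi> y"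
     "\<forall>c. \<forall>x\<in>zH2. \<phi> (c *\<^sub>C x) = c * \<phi> x"
     "\<forall>x\<in>zH2. cmod (\<phi> x) \<le> K * norm x"
  obtain y where y: "\<And>x. \<phi> (shift x) = cinner x y"
  proof (rule riesz_spaceD[OF riesz_space_hardy, of "\<lambda>x. \<phi> (shift x)" K])
    show "cmod (\<phi> (shift x)) \<le> K * norm x" for x
      using *(3)[rule_format, of "shift x"] by (simp add: zH2_def)
  qed (use * in \<open>auto simp: zH2_def shift_add shift_scaleC\<close>)
  show "\<exists>y\<in>zH2. \<forall>x\<in>zH2. \<phi> x = cinner x y"
    by (rule bexI[of _ "shift y"]) (auto simp: zH2_def y cinner_shift_left)
qed

section \<open>The operator equation\<close>

lemma bounded_ops_comp:
  assumes "T \<in> bounded_ops M N" "U \<in> bounded_ops N L"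
  shows "(\<lambda>x. U (T x)) \<in> bounded_ops M L"
proof -
  obtain K where K: "\<And>x. x \<in> M \<Longrightarrow> norm (T x) \<le> K * norm x"
    using assms(1) unfolding bounded_ops_def by blast
  obtain J where J: "\<And>x. x \<in> N \<Longrightarrow> norm (U x) \<le> J * norm x"
    using assms(2) unfolding bounded_ops_def by blast
  \<comment> \<open>The constant \<open>J\<close> may be negative; its absolute value makes
    multiplication by it monotone.\<close>
  have "norm (U (T x)) \<le> (\<bar>J\<bar> * K) * norm x" if x: "x \<in> M" for x
  proof -
    have "norm (U (T x)) \<le> J * norm (T x)" using assms x by (intro J) (auto simp: bounded_ops_def)
    also have "\<dots> \<le> \<bar>J\<bar> * norm (T x)" by (simp add: mult_right_mono)
    also have "\<dots> \<le> \<bar>J\<bar> * (K * norm x)" using K[OF x] by (simp add: mult_left_mono)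
    finally show ?thesis by (simp add: mult.assoc)
  qed
  moreover have "\<forall>x\<in>M. U (T x) \<in> L" "\<forall>x\<in>M. \<forall>y\<in>M. U (T (x + y)) = U (T x) + U (T y)"
    "\<forall>c. \<forall>x\<in>M. U (T (c *\<^sub>C x)) = c *\<^sub>C U (T x)"
    using assms by (auto simp: bounded_ops_def)
  ultimately show ?thesis unfolding bounded_ops_def by blast
qed

lemma bounded_ops_mono:
  "T \<in> bounded_ops M N \<Longrightarrow> M' \<subseteq> M \<Longrightarrow> N \<subseteq> N' \<Longrightarrow> T \<in> bounded_ops M' N'"
  unfolding bounded_ops_def by blast

lemma bounded_ops_Pair_0: "(\<lambda>x. (x, 0)) \<in> bounded_ops UNIV UNIV"
  "(\<lambda>x. (0, x)) \<in> bounded_ops UNIV UNIV"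
  by (auto simp: bounded_ops_def scaleC_prod_def norm_Pair intro!: exI[of _ 1])

lemma bounded_ops_fst_snd: "fst \<in> bounded_ops UNIV UNIV" "snd \<in> bounded_ops UNIV UNIV"
  by (auto simp: bounded_ops_def scaleC_prod_def norm_fst_le norm_snd_le intro!: exI[of _ 1])

text \<open>The codomain is kept as small as \<open>zH2\<close> because the entry \<open>D\<close>
  must map into it.\<close>

lemma bounded_ops_shift: "shift \<in> bounded_ops UNIV zH2"
  by (auto simp: bounded_ops_def zH2_def shift_add shift_scaleC intro!: exI[of _ 1])

lemma bounded_ops_adj_shift: "adj shift \<in> bounded_ops UNIV UNIV"
  by (auto simp: bounded_ops_def adj_shift_add adj_shift_scaleC norm_adj_shift_le intro!: exI[of _ 1])

lemma bounded_ops_ortho_proj: "ortho_proj constants \<in> bounded_ops UNIV constants"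
  unfolding bounded_ops_def ortho_proj_constants
  by (auto simp: hcoeff_add hcoeff_scaleC const_hardy_add const_hardy_mult norm_const_hardy
      norm_hcoeff_le constants_def intro!: exI[of _ 1])

lemma adj_map_prod_shift: "adj (map_prod shift (adj shift)) = map_prod (adj shift) shift"
  by (rule ext, rule adjoint_on_eqI[OF riesz_space_prod[OF riesz_space_hardy riesz_space_hardy]])
    (auto simp: cinner_prod_def cinner_shift_left cinner_shift_right)

text \<open>Both adjoints on the right move across the inner product, and vectors with equal inner
  products against all \<open>u\<close> coincide.\<close>

lemma operator_equation_iff_symmetric:
  fixes Y :: "hardy \<times> hardy \<Rightarrow> hardy \<times> hardy"
  assumes Y: "Y \<in> bounded_ops UNIV UNIV"
  defines "W \<equiv> map_prod shift (adj shift)"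
  shows "W \<circ> Y = adj Y \<circ> adj W \<longleftrightarrow> (\<forall>u v. cinner (W (Y u)) v = cinner u (W (Y v)))"
proof -
  have adjY: "cinner (Y u) v = cinner u (adj Y v)" for u v
    using adjoint_on(2)[OF riesz_space_prod[OF riesz_space_hardy riesz_space_hardy] Y] by simp
  have "cinner (W p) q = cinner p (adj W q)" for p q
    unfolding W_def adj_map_prod_shift
    by (auto simp: cinner_prod_def cinner_shift_left cinner_shift_right)
  then have "(\<forall>u v. cinner (W (Y u)) v = cinner u (W (Y v))) \<longleftrightarrow>
      (\<forall>v u. cinner u (adj Y (adj W v)) = cinner u (W (Y v)))"
    by (auto simp: adjY)
  also have "\<dots> \<longleftrightarrow> (\<forall>v. W (Y v) = adj Y (adj W v))" by (metis cinner_ext)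
  finally show ?thesis by (auto simp: fun_eq_iff)
qed

theorem theorem3p9:
  fixes Y :: "hardy \<times> hardy \<Rightarrow> hardy \<times> hardy"
  assumes "Y \<in> bounded_ops UNIV UNIV"
  shows "map_prod shift (adj shift) \<circ> Y = adj Y \<circ> adj (map_prod shift (adj shift)) \<longleftrightarrow>
    (\<exists>Y21 T A11 A22 B22 a g D.
       Y21 \<in> bounded_ops UNIV UNIV \<and> T \<in> bounded_ops UNIV UNIV \<and>
       selfadjoint_op A11 \<and> selfadjoint_op A22 \<and> selfadjoint_op B22 \<and>
       g \<in> bounded_ops zH2 constants \<and> D \<in> bounded_ops zH2 zH2 \<and>
       has_op_matrix constants zH2 Y21
         (scaleC a) g
         (\<lambda>_. 0)    D \<and>
       Y = block_op
         (A11 \<circ> adj shift)  (adj shift \<circ> adjoint_on zH2 zH2 D \<circ> shift)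
         Y21                (\<lambda>f. ortho_proj constants (T f) + A22 (shift f) + shift (B22 f)))"
  (is "?equation \<longleftrightarrow> ?form")
proof

  \<comment> \<open>From the operator equation to the block form\<close>
  assume ?equation
  then have sym: "cinner (map_prod shift (adj shift) (Y u)) v
      = cinner u (map_prod shift (adj shift) (Y v))" for u v
    using operator_equation_iff_symmetric[OF assms] by blast
  define Y11 Y12 Y21 Y22 where Yij: "Y11 = (\<lambda>x. fst (Y (x, 0)))" "Y12 = (\<lambda>x. fst (Y (0, x)))"
    "Y21 = (\<lambda>x. snd (Y (x, 0)))" "Y22 = (\<lambda>x. snd (Y (0, x)))"
  have bdd: "Y11 \<in> bounded_ops UNIV UNIV" "Y21 \<in> bounded_ops UNIV UNIV"
    "Y22 \<in> bounded_ops UNIV UNIV"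
    unfolding Yij
    by (rule bounded_ops_comp[OF bounded_ops_comp[OF _ assms]], rule bounded_ops_Pair_0,
        rule bounded_ops_fst_snd)+
  have Y: "Y (x, y) = (Y11 x + Y12 y, Y21 x + Y22 y)" for x y
  proof -
    have "Y (x, y) = Y ((x, 0) + (0, y))" by simp
    also have "\<dots> = Y (x, 0) + Y (0, y)" using assms by (simp only: bounded_ops_def) blast
    finally show ?thesis by (simp add: Yij plus_prod_def)
  qed
  \<comment> \<open>Testing symmetry on vectors supported in one coordinate gives one condition per
    block; the mixed pair says that S* Y21 is adjoint to S Y12.\<close>
  have s11: "cinner (shift (Y11 x)) y = cinner x (shift (Y11 y))" for x y
    using sym[of "(x, 0)" "(y, 0)"] by (simp add: cinner_prod_def Yij)
  have s22: "cinner (adj shift (Y22 x)) y = cinner x (adj shift (Y22 y))" for x y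
    using sym[of "(0, x)" "(0, y)"] by (simp add: cinner_prod_def Yij)
  have s21: "cinner (adj shift (Y21 x)) y = cinner x (shift (Y12 y))" for x y
    using sym[of "(x, 0)" "(0, y)"] by (simp add: cinner_prod_def Yij)

  have add: "Y11 (x + y) = Y11 x + Y11 y" "Y21 (x + y) = Y21 x + Y21 y" for x y
    using bdd by (auto simp: bounded_ops_def)
  have scale: "Y21 (c *\<^sub>C x) = c *\<^sub>C Y21 x" for c x
    using bdd by (auto simp: bounded_ops_def)
  \<comment> \<open>For constant c the product of S Y11 c with any u equals that of c with S Y11 u,
    which is 0 because S* kills c; then S is injective.\<close>
  have Y11_const: "Y11 (const_hardy c) = 0" for c
  proof -
    have "shift (Y11 (const_hardy c)) = 0"
      by (intro cinner_ext) (metis adj_shift_const cinner_shift_left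
          cinner_shift_right cinner_zero_right cinner_commute s11)
    then show ?thesis by (metis norm_shift norm_eq_zero)
  qed
  \<comment> \<open>The same argument with the mixed condition: a vector annihilated by S* is
    constant, which yields \<open>a\<close> and the zero corner of the matrix.\<close>
  have "adj shift (Y21 (const_hardy 1)) = 0"
    by (intro cinner_ext) (metis adj_shift_const cinner_shift_right cinner_zero_left
        cinner_zero_right cinner_commute s21)
  then obtain a where a: "Y21 (const_hardy 1) = const_hardy a"
    by (metis const_plus_shift[of "Y21 (const_hardy 1)"] add_0_right norm_shift norm_eq_zero norm_zero)
  have Y21_const: "Y21 (const_hardy c) = a *\<^sub>C const_hardy c" for c
    using scale[of c "const_hardy 1"] a by (simp flip: const_hardy_mult) (simp add: mult.commute)

  \<comment> \<open>The witnesses are A11 = Y11 S, B22 = S* Y22, A22 = 0 and T = Y22;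
    \<open>g\<close> and \<open>D\<close> are the components P Y21 and S S* Y21.\<close>
  define A where "A = (\<lambda>x. Y11 (shift x))"
  define B where "B = (\<lambda>x. adj shift (Y22 x))"
  define g where "g = (\<lambda>x. ortho_proj constants (Y21 x))"
  define D where "D = (\<lambda>x. shift (adj shift (Y21 x)))"
  have A: "selfadjoint_op A"
    unfolding selfadjoint_op_iff[OF riesz_space_hardy]
  proof (intro conjI allI)
    show "A \<in> bounded_ops UNIV UNIV"
      unfolding A_def by (rule bounded_ops_comp[OF bounded_ops_mono[OF bounded_ops_shift] bdd(1)]) auto
    show "cinner (A x) y = cinner x (A y)" for x y
      using s11[of "shift x" "shift y"] by (simp add: A_def cinner_shift_left cinner_shift_right)
  qed
  have B: "selfadjoint_op B"
    unfolding selfadjoint_op_iff[OF riesz_space_hardy]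
  proof (intro conjI allI)
    show "B \<in> bounded_ops UNIV UNIV"
      unfolding B_def by (rule bounded_ops_comp[OF bdd(3) bounded_ops_adj_shift])
    show "cinner (B x) y = cinner x (B y)" for x y by (simp add: B_def s22)
  qed
  have zero: "selfadjoint_op (\<lambda>_. 0 :: hardy)"
    by (auto simp: selfadjoint_op_iff[OF riesz_space_hardy] bounded_ops_def intro!: exI[of _ 0])
  have g: "g \<in> bounded_ops zH2 constants"
    unfolding g_def
    by (rule bounded_ops_mono[OF bounded_ops_comp[OF bdd(2) bounded_ops_ortho_proj]]) auto
  have D: "D \<in> bounded_ops zH2 zH2"
    unfolding D_def
    by (rule bounded_ops_mono[OF bounded_ops_comp[OF bounded_ops_comp[OF bdd(2)
            bounded_ops_adj_shift] bounded_ops_shift]]) auto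
  \<comment> \<open>On the range of the shift the mixed condition reads D* S = S Y12, so applying S*
    recovers the upper right block.\<close>
  have D_adj: "adjoint_on zH2 zH2 D (shift y) = shift (Y12 y)" for y
    by (rule adjoint_on_eqI[OF riesz_space_zH2])
      (auto simp: zH2_def D_def cinner_shift_left[of "adj shift _"] s21)
  have mat: "has_op_matrix constants zH2 Y21 (scaleC a) g (\<lambda>_. 0) D"
    unfolding has_op_matrix_def
  proof (intro conjI g D ballI)
    show "scaleC a \<in> bounded_ops constants constants"
      by (auto simp: bounded_ops_def scaleC_add_right scaleC_scaleC mult_ac constants_def
          norm_const_hardy norm_mult simp flip: const_hardy_mult intro!: exI[of _ "cmod a"])
    show "(\<lambda>_. 0) \<in> bounded_ops constants zH2"
      by (auto simp: bounded_ops_def zH2_def shift_diff[of 0 0, simplified]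
          intro!: exI[of _ 0] range_eqI[of _ _ 0])
    fix x y assume "x \<in> constants"
    then have "Y21 x = a *\<^sub>C x" by (auto simp: constants_def Y21_const)
    then show "Y21 (x + y) = a *\<^sub>C x + g y + (0 + D y)"
      by (simp add: add g_def D_def ortho_proj_constants const_plus_shift add.assoc)
  qed
  have "Y = block_op (A \<circ> adj shift) (adj shift \<circ> adjoint_on zH2 zH2 D \<circ> shift) Y21
      (\<lambda>f. ortho_proj constants (Y22 f) + (\<lambda>_. 0) (shift f) + shift (B f))"
  proof
    fix p :: "hardy \<times> hardy"
    obtain x y where p: "p = (x, y)" by fastforce
    \<comment> \<open>Split \<open>x\<close> by I = P + S S*: the constant part contributes
      nothing.\<close>
    have "Y11 x = A (adj shift x)"
      using add(1)[of "const_hardy (hcoeff x 0)" "shift (adj shift x)"]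
      by (simp add: const_plus_shift A_def Y11_const)
    then show "Y p = block_op (A \<circ> adj shift) (adj shift \<circ> adjoint_on zH2 zH2 D \<circ> shift) Y21
      (\<lambda>f. ortho_proj constants (Y22 f) + (\<lambda>_. 0) (shift f) + shift (B f)) p"
      by (simp add: p Y block_op_def D_adj B_def ortho_proj_constants const_plus_shift)
  qed
  then show ?form
    by (intro exI[of _ Y21] exI[of _ Y22] exI[of _ A] exI[of _ "\<lambda>_. 0"] exI[of _ B] exI[of _ a]
        exI[of _ g] exI[of _ D] conjI bdd A zero B g D mat)
next

  \<comment> \<open>From the block form to the operator equation\<close>
  assume ?form
  then obtain Y21 T A11 A22 B22 a g D where
    sa: "selfadjoint_op A11" "selfadjoint_op A22" "selfadjoint_op B22"
    and g: "g \<in> bounded_ops zH2 constants" and D: "D \<in> bounded_ops zH2 zH2"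
    and mat: "has_op_matrix constants zH2 Y21 (scaleC a) g (\<lambda>_. 0) D"
    and Y: "Y = block_op (A11 \<circ> adj shift) (adj shift \<circ> adjoint_on zH2 zH2 D \<circ> shift) Y21
      (\<lambda>f. ortho_proj constants (T f) + A22 (shift f) + shift (B22 f))"
    by blast
  have A: "cinner (A11 x) y = cinner x (A11 y)" "cinner (A22 x) y = cinner x (A22 y)"
    "cinner (B22 x) y = cinner x (B22 y)" for x y
    using sa by (auto simp: selfadjoint_op_iff[OF riesz_space_hardy])
  define Ds where "Ds = adjoint_on zH2 zH2 D"
  have "Ds y \<in> zH2" for y
    using adjoint_on(1)[OF riesz_space_zH2 D] by (simp add: Ds_def)
  \<comment> \<open>S S* is the identity on \<open>zH2\<close>, so S applied to the upper right
    block is D* S.\<close>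
  then have shift_Ds: "shift (adj shift (Ds y)) = Ds y" for y
    by (metis adj_shift_shift zH2_def rangeE)
  have D_adj: "cinner (adj shift (D (shift x))) y = cinner x (adj shift (Ds (shift y)))" for x y
    using adjoint_on(2)[OF riesz_space_zH2 D, of "shift x" "shift y"]
    by (simp add: Ds_def zH2_def cinner_shift_left cinner_shift_right)
  \<comment> \<open>The terms with \<open>a\<close> and \<open>g\<close> take constant values, which
    S* removes; only \<open>D\<close> survives.\<close>
  have Y21: "adj shift (Y21 x) = adj shift (D (shift (adj shift x)))" for x
  proof -
    have "Y21 (const_hardy (hcoeff x 0) + shift (adj shift x))
      = a *\<^sub>C const_hardy (hcoeff x 0) + g (shift (adj shift x)) + D (shift (adj shift x))"
      using mat by (auto simp: has_op_matrix_def constants_def zH2_def)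
    moreover obtain c where "g (shift (adj shift x)) = const_hardy c"
      using g unfolding bounded_ops_def zH2_def constants_def by blast
    ultimately show ?thesis by (simp add: const_plus_shift adj_shift_add adj_shift_scaleC)
  qed
  have s21: "cinner (adj shift (Y21 x)) y = cinner x (Ds (shift y))" for x y
    using D_adj[of "adj shift x" y] by (metis Y21 cinner_shift_right shift_Ds)
  have s12: "cinner (Ds (shift y)) x = cinner y (adj shift (Y21 x))" for x y
    using s21[of x y] by (metis cinner_commute)
  have s22: "cinner (adj shift (A22 (shift x))) y = cinner x (adj shift (A22 (shift y)))" for x y
    by (simp add: A flip: cinner_shift_left cinner_shift_right)
  \<comment> \<open>The diagonal blocks are now S A11 S* and S* A22 S + B22, because S* P = 0 and S*
    S = I; the off-diagonal blocks D* S and S* Y21 are mutually adjoint.\<close>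
  have "cinner (map_prod shift (adj shift) (Y u)) v
      = cinner u (map_prod shift (adj shift) (Y v))" for u v
  proof -
    obtain x y x' y' where "u = (x, y)" "v = (x', y')" by fastforce
    then show ?thesis
      by (simp add: Y block_op_def cinner_prod_def shift_add adj_shift_add cinner_add_left
          cinner_add_right ortho_proj_constants s21 s12 s22 A shift_Ds cinner_shift_left
          cinner_shift_right flip: Ds_def)
  qed
  then show ?equation using operator_equation_iff_symmetric[OF assms] by blast
qed

end
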